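(* Every number system $(\mathbb{Z},b,\mathcal{D})$ has a unique zero expansion of minimal length.
   Context: A pre-number system $(\mathbb{Z},b,\mathcal{D})$ consists of an integer $b$ with $|b|\ge 2$ and a finite set $\mathcal{D}\subset\mathbb{Z}$ covering all residue classes modulo $b$; $\mathcal{D}$ is assumed irredundant, i.e. $|\mathcal{D}|=|b|$, so it has exactly one element in each residue class. It is a number system if every $a\in\mathbb{Z}$ can be written as $a=\sum_{i=0}^{\ell-1}d_ib^i$ with $\ell\ge 1$ and all $d_i\in\mathcal{D}$. A zero expansion of $(\mathbb{Z},b,\mathcal{D})$ is a sequence $(d_0,\ldots,d_{\ell-1})$ of digits in $\mathcal{D}$ with $\ell\ge 1$ (its length is $\ell$) such that $\sum_{i=0}^{\ell-1}d_ib^i=0$. *)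

theory Defs
  imports "HOL-Number_Theory.Cong"
begin

text \<open>Digit sequences are lists, with the least significant digit first.\<close>

definition pre_number_system :: "int \<Rightarrow> int set \<Rightarrow> bool" where
  "pre_number_system b D \<longleftrightarrow>
     2 \<le> \<bar>b\<bar> \<and> finite D \<and> (\<forall>a. \<exists>d\<in>D. [a = d] (mod b))"

definition irredundant :: "int \<Rightarrow> int set \<Rightarrow> bool" where
  "irredundant b D \<longleftrightarrow> int (card D) = \<bar>b\<bar>"

definition digit_value :: "int \<Rightarrow> int list \<Rightarrow> int" where
  "digit_value b ds = (\<Sum>i<length ds. ds ! i * b ^ i)"

definition expansion :: "int \<Rightarrow> int set \<Rightarrow> int \<Rightarrow> int list \<Rightarrow> bool" where
  "expansion b D a ds \<longleftrightarrow> 1 \<le> length ds \<and> set ds \<subseteq> D \<and> a = digit_value b ds"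

definition number_system :: "int \<Rightarrow> int set \<Rightarrow> bool" where
  "number_system b D \<longleftrightarrow>
     pre_number_system b D \<and> irredundant b D \<and> (\<forall>a. \<exists>ds. expansion b D a ds)"

definition zero_expansion :: "int \<Rightarrow> int set \<Rightarrow> int list \<Rightarrow> bool" where
  "zero_expansion b D ds \<longleftrightarrow> expansion b D 0 ds"

end

theory Submission
  imports Defs
begin

text \<open>An irredundant digit set has pairwise incongruent elements modulo \<open>b\<close>, so the digits of an
  expansion are forced one after the other, starting from the least significant one: two expansions
  of the same length and value agree.\<close>

lemma digit_value_Cons: "digit_value b (d # ds) = d + b * digit_value b ds"
  unfolding digit_value_def
  by (simp add: sum.lessThan_Suc_shift sum_distrib_left mult.left_commute del: sum.lessThan_Suc)

text \<open>Reduction modulo \<open>\<bar>b\<bar>\<close> maps \<open>D\<close> onto a complete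
  residue system with as many elements as \<open>D\<close>, so it is injective on
  \<open>D\<close>.\<close>

lemma irredundant_digits_incongruent:
  assumes "pre_number_system b D" and "irredundant b D"
    and "d \<in> D" and "e \<in> D" and "b dvd d - e"
  shows "d = e"
proof -
  have fin: "finite D" and cov: "\<And>a. \<exists>d\<in>D. [a = d] (mod b)"
    using assms(1) by (auto simp: pre_number_system_def)
  \<comment> \<open>The absolute value puts the residues in \<open>{0..<\<bar>b\<bar>}\<close> even
    for negative \<open>b\<close>.\<close>
  let ?f = "\<lambda>d. d mod \<bar>b\<bar>"
  have "{0..<\<bar>b\<bar>} \<subseteq> ?f ` D"
  proof
    fix r assume r: "r \<in> {0..<\<bar>b\<bar>}"
    obtain d where d: "d \<in> D" "[r = d] (mod b)" using cov by blast
    then have "r mod \<bar>b\<bar> = d mod \<bar>b\<bar>"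
      by (simp add: cong_iff_dvd_diff mod_eq_dvd_iff)
    with r d(1) show "r \<in> ?f ` D" by (intro image_eqI[of _ _ d]) auto
  qed
  then have "card {0..<\<bar>b\<bar>} \<le> card (?f ` D)"
    using fin by (intro card_mono) auto
  moreover have "card {0..<\<bar>b\<bar>} = card D"
    using assms(2) by (simp add: irredundant_def)
  ultimately have "inj_on ?f D"
    using card_image_le[OF fin, of ?f] fin by (intro eq_card_imp_inj_on) auto
  moreover have "?f d = ?f e" using assms(5) by (simp add: mod_eq_dvd_iff)
  ultimately show ?thesis using assms(3,4) by (auto dest: inj_onD)
qed

lemma digit_value_inj_same_length:
  assumes "pre_number_system b D" and "irredundant b D"
    and "length ds = length es" and "set ds \<subseteq> D" and "set es \<subseteq> D"
    and "digit_value b ds = digit_value b es"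
  shows "ds = es"
  using assms(3-6)
proof (induction ds es rule: list_induct2)
  case Nil
  show ?case ..
next
  case (Cons d ds e es)
  have eq: "d - e = b * (digit_value b es - digit_value b ds)"
    using Cons.prems(3) by (simp add: digit_value_Cons algebra_simps)
  then have "d = e"
    using irredundant_digits_incongruent[OF assms(1,2)] Cons.prems(1,2) by simp
  \<comment> \<open>With \<open>d = e\<close>, cancelling \<open>b\<close> in \<open>eq\<close>
    shows that the tails have equal values, as the induction hypothesis requires.\<close>
  moreover have "b \<noteq> 0" using assms(1) by (auto simp: pre_number_system_def)
  ultimately show ?case using eq Cons.IH Cons.prems(1,2) by simp
qed

theorem theorem2p11:
  fixes b :: int and D :: "int set"
  assumes "number_system b D"
  shows "\<exists>!ds. is_arg_min length (zero_expansion b D) ds"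
proof (rule ex_ex1I)
  \<comment> \<open>In a number system \<open>0\<close> is representable, and the lengths of its
    expansions are natural numbers, so a least one exists.\<close>
  obtain ds where "zero_expansion b D ds"
    using assms by (auto simp: number_system_def zero_expansion_def)
  then show "\<exists>ds. is_arg_min length (zero_expansion b D) ds"
    using ex_has_least_nat[of "zero_expansion b D" ds length]
    by (auto simp: is_arg_min_linorder)
next
  fix ds es
  assume "is_arg_min length (zero_expansion b D) ds" "is_arg_min length (zero_expansion b D) es"
  \<comment> \<open>Each minimizer is no longer than the other, which supplies the equal lengths
    needed for digitwise comparison.\<close>
  then have "zero_expansion b D ds" "zero_expansion b D es" "length ds = length es"
    by (auto simp: is_arg_min_linorder intro: order_antisym)
  then show "ds = es"
    using assms digit_value_inj_same_length[of b D ds es]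
    by (simp add: number_system_def zero_expansion_def expansion_def)
qed

end
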